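(* Let $L$ and $S$ be positive integers, let $\beta\in(0,1)$ be the real number with $L\beta+S\beta^2=1$, let $\{\rho_{L,S}^n\}_{n\ge 1}$ be the $LS$-sequence of partitions of $[0,1]$, let $t_n$ be the number of intervals of $\rho_{L,S}^n$, and let $D(\rho_{L,S}^n)$ be the discrepancy of $\rho_{L,S}^n$. Then, as $n\to\infty$: (i) if $S<L+1$, then $D(\rho_{L,S}^n)\sim \dfrac{1}{t_n}$; (ii) if $S=L+1$, then $D(\rho_{L,S}^n)\sim \dfrac{\log t_n}{t_n}$; (iii) if $S>L+1$, then $D(\rho_{L,S}^n)\sim \dfrac{1}{t_n^{\gamma}}$, where $\gamma=1+\dfrac{\log(S\beta)}{\log\beta}$. Here, for positive sequences $a_n$ and $b_n$, $a_n\sim b_n$ means that $a_n$ and $b_n$ have the same order: there exist constants $0<c\le C<\infty$ (which may depend on $L$ and $S$ but not on $n$) such that $c\,b_n\le a_n\le C\,b_n$ for all sufficiently large $n$.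
   Context: Partitions of $[0,1]$ are finite partitions into consecutive intervals, $\pi=\{[y_{i-1},y_i[\,:\,1\le i\le k\}$ with $0=y_0<y_1<\dots<y_k=1$. Refinement: given a non-trivial finite partition $\rho$ of $[0,1]$ and a partition $\pi$ of $[0,1]$, the $\rho$-refinement $\rho\pi$ of $\pi$ is the partition obtained by subdividing every interval of $\pi$ of maximal length positively (directly, i.e. orientation-preservingly) homothetically to $\rho$, leaving the other intervals of $\pi$ unchanged. Set $\rho^1\pi=\rho\pi$ and let $\rho^n\pi$ be the $\rho$-refinement of $\rho^{n-1}\pi$. Let $\omega=\{[0,1]\}$ be the trivial partition. $LS$-sequences: for positive integers $L,S$, let $\beta\in(0,1)$ satisfy $L\beta+S\beta^2=1$. Let $\rho_{L,S}$ be the partition of $[0,1]$ consisting, from left to right, of $L$ long intervals of length $\beta$ followed by $S$ short intervals of length $\beta^2$. The $LS$-sequence of partitions is $\{\rho_{L,S}^n\}=\{\rho_{L,S}^n\,\omega\}$, the sequence of successive $\rho_{L,S}$-refinements of $\omega$. Write $t_n$ for the number of intervals of $\rho_{L,S}^n$. Discrepancy: for a partition $\pi=\{[y_{i-1},y_i[\,:\,1\le i\le k\}$ of $[0,1]$, $$D(\pi)=\sup_{0\le a<b\le 1}\left|\frac1k\sum_{j=1}^{k}\chi_{[a,b[}(y_j)-(b-a)\right|,$$ where $\chi_{[a,b[}$ is the indicator function of the half-open interval $[a,b[=\{x: a\le x<b\}$. *)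

theory Defs
  imports Complex_Main "HOL-Library.Indicator_Function"
begin

text \<open>
  A finite partition of \<open>[0,1]\<close> into consecutive intervals \<open>[y\<^sub>i\<^sub>-\<^sub>1, y\<^sub>i[\<close> is represented by the finite
  set of the endpoint pairs \<open>(y\<^sub>i\<^sub>-\<^sub>1, y\<^sub>i)\<close>; the number of its intervals is then \<open>card\<close>.
\<close>

type_synonym partition = "(real \<times> real) set"

definition trivial_partition :: partition where
  "trivial_partition = {(0, 1)}"

definition max_length :: "partition \<Rightarrow> real" where
  "max_length \<pi> = Max ((\<lambda>(u, v). v - u) ` \<pi>)"

text \<open>The image of \<open>\<rho>\<close> under the increasing affine map of \<open>[0,1]\<close> onto \<open>[u,v]\<close>.\<close>

definition homothetic_copy :: "partition \<Rightarrow> real \<Rightarrow> real \<Rightarrow> partition" where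
  "homothetic_copy \<rho> u v = (\<lambda>(c, d). (u + (v - u) * c, u + (v - u) * d)) ` \<rho>"

definition refinement :: "partition \<Rightarrow> partition \<Rightarrow> partition" where
  "refinement \<rho> \<pi> =
     (\<Union>(u, v)\<in>\<pi>. if v - u = max_length \<pi> then homothetic_copy \<rho> u v else {(u, v)})"

definition rho_LS :: "nat \<Rightarrow> nat \<Rightarrow> real \<Rightarrow> partition" where
  "rho_LS L S \<beta> =
     (\<lambda>i. (real i * \<beta>, real (i + 1) * \<beta>)) ` {..<L} \<union>
     (\<lambda>j. (real L * \<beta> + real j * \<beta>^2, real L * \<beta> + real (j + 1) * \<beta>^2)) ` {..<S}"

definition LS_partition :: "nat \<Rightarrow> nat \<Rightarrow> real \<Rightarrow> nat \<Rightarrow> partition" where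
  "LS_partition L S \<beta> n = (refinement (rho_LS L S \<beta>) ^^ n) trivial_partition"

text \<open>
  The points counted are the right endpoints \<open>y\<^sub>1, \<dots>, y\<^sub>k\<close> of the intervals, so \<open>1\<close> is among them
  and \<open>0\<close> is not.
\<close>

definition discrepancy :: "partition \<Rightarrow> real" where
  "discrepancy \<pi> =
     (SUP (a, b)\<in>{(a, b). 0 \<le> a \<and> a < b \<and> b \<le> 1}.
        \<bar>1 / real (card \<pi>) * (\<Sum>(u, y)\<in>\<pi>. indicator {a..<b} y) - (b - a)\<bar>)"

definition same_order :: "(nat \<Rightarrow> real) \<Rightarrow> (nat \<Rightarrow> real) \<Rightarrow> bool" where
  "same_order f g \<longleftrightarrow>
     (\<exists>c C. 0 < c \<and> c \<le> C \<and> (\<forall>\<^sub>F n in sequentially. c * g n \<le> f n \<and> f n \<le> C * g n))"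

end

theory Submission
  imports Defs
begin

text \<open>
  Refining \<open>n + 1\<close> times amounts to placing the \<open>n\<close>-fold refinement in each long interval of
  \<open>\<rho>\<^sub>L\<^sub>,\<^sub>S\<close> and the \<open>(n - 1)\<close>-fold one in each short interval. Let \<open>E n x\<close> be the
  number of endpoints below \<open>x\<close> minus \<open>x\<close> times the number \<open>T n\<close> of intervals. Self-similarity gives a recursion for \<open>E\<close>
  in which each step adds a bounded multiple of the defects
  \<open>\<delta> n = T n - \<beta> T (n + 1)\<close>, and \<open>\<delta> n = (1 - \<beta>) (- S \<beta>)\<^sup>n\<close> exactly. Hence \<open>E n\<close> is bounded by a constant
  plus a multiple of \<open>\<Sum>k<n. (S \<beta>)\<^sup>k\<close>, and the three cases are \<open>S \<beta> < 1\<close>, \<open>S \<beta> = 1\<close>, \<open>S \<beta> > 1\<close>.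
  Lower bounds come from \<open>E n 1 = -1\<close>, from a nested sequence of cells along which the alternating
  defects add up, and from the value \<open>E n \<beta>\<close>, respectively.
\<close>

section \<open>Refinement at a prescribed length, and affine copies\<close>

text \<open>\<open>max_length\<close> depends on the whole partition. With the length as a
  parameter, refinement acts cell by cell, so it commutes with unions and, once the length is
  rescaled, with affine copies.\<close>

definition refine_at :: "partition \<Rightarrow> real \<Rightarrow> partition \<Rightarrow> partition" where
  "refine_at \<rho> l \<pi> =
     (\<Union>(u, v)\<in>\<pi>. if v - u = l then homothetic_copy \<rho> u v else {(u, v)})"

lemma refinement_eq_refine_at: "refinement \<rho> \<pi> = refine_at \<rho> (max_length \<pi>) \<pi>"
  by (simp add: refinement_def refine_at_def)

lemma homothetic_copy_trivial [simp]: "homothetic_copy {(0, 1)} u v = {(u, v)}"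
  by (simp add: homothetic_copy_def)

lemma homothetic_copy_0_1 [simp]: "homothetic_copy \<rho> 0 1 = \<rho>"
  by (force simp: homothetic_copy_def)

lemma homothetic_copy_copy:
  "homothetic_copy (homothetic_copy \<rho> u v) p q =
     homothetic_copy \<rho> (p + (q - p) * u) (p + (q - p) * v)"
  unfolding homothetic_copy_def image_image
  by (rule image_cong) (auto simp: algebra_simps)

lemma homothetic_copy_UN:
  "homothetic_copy (\<Union>i\<in>I. A i) u v = (\<Union>i\<in>I. homothetic_copy (A i) u v)"
  by (auto simp: homothetic_copy_def)

lemma homothetic_copy_eq_UN:
  "homothetic_copy \<pi> p q = (\<Union>(u, v)\<in>\<pi>. {(p + (q - p) * u, p + (q - p) * v)})"
  by (auto simp: homothetic_copy_def)

lemma refine_at_UN: "refine_at \<rho> l (\<Union>i\<in>I. A i) = (\<Union>i\<in>I. refine_at \<rho> l (A i))"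
  by (auto simp: refine_at_def)

lemma refine_at_copy:
  assumes "p < q"
  shows "refine_at \<rho> ((q - p) * l) (homothetic_copy \<pi> p q) =
    homothetic_copy (refine_at \<rho> l \<pi>) p q"
proof -
  have len: "p + (q - p) * v - (p + (q - p) * u) = (q - p) * l \<longleftrightarrow> v - u = l" for u v
  proof -
    have "p + (q - p) * v - (p + (q - p) * u) = (q - p) * (v - u)"
      by (simp add: algebra_simps)
    then show ?thesis using assms by simp
  qed
  have "refine_at \<rho> ((q - p) * l) (homothetic_copy \<pi> p q) =
      (\<Union>(u, v)\<in>\<pi>. refine_at \<rho> ((q - p) * l) {(p + (q - p) * u, p + (q - p) * v)})"
    unfolding homothetic_copy_eq_UN[of \<pi>] by (simp add: refine_at_UN case_prod_beta)
  also have "\<dots> = (\<Union>(u, v)\<in>\<pi>. homothetic_copy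
      (if v - u = l then homothetic_copy \<rho> u v else {(u, v)}) p q)"
  proof (intro SUP_cong refl, clarify)
    fix u v
    show "refine_at \<rho> ((q - p) * l) {(p + (q - p) * u, p + (q - p) * v)} =
      homothetic_copy (if v - u = l then homothetic_copy \<rho> u v else {(u, v)}) p q"
      unfolding refine_at_def
      by (simp only: UN_insert UN_empty Un_empty_right prod.case len homothetic_copy_copy if_distrib
        homothetic_copy_eq_UN[of "{(u, v)}"] split: if_split) simp
  qed
  also have "\<dots> = homothetic_copy (refine_at \<rho> l \<pi>) p q"
    unfolding refine_at_def homothetic_copy_UN by (simp add: case_prod_beta)
  finally show ?thesis .
qed

section \<open>Counting right endpoints in a partition and across a tiling of
  \<open>[0,1]\<close>\<close>

text \<open>The inequality is strict so that a difference of two values counts the points of a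
  half-open \<open>[a,b[\<close>.\<close>

definition count_below :: "partition \<Rightarrow> real \<Rightarrow> nat" where
  "count_below \<pi> x = card {p \<in> \<pi>. snd p < x}"

text \<open>Right endpoints in \<open>]0,1]\<close> go to \<open>]p,q]\<close> under an affine copy,
  so copies placed in different cells share no pair.\<close>

definition unit_cells :: "partition \<Rightarrow> bool" where
  "unit_cells \<pi> \<longleftrightarrow> finite \<pi> \<and> (\<forall>(u, v)\<in>\<pi>. 0 < v \<and> v \<le> 1)"

lemma affine_between:
  fixes p q x :: real
  assumes "p < q" "0 < x" "x \<le> 1"
  shows "p < p + (q - p) * x" "p + (q - p) * x \<le> q"
proof -
  have "0 < (q - p) * x" using assms by simp
  moreover have "(q - p) * x \<le> q - p" by (rule mult_left_le) (use assms in simp_all)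
  ultimately show "p < p + (q - p) * x" "p + (q - p) * x \<le> q" by linarith+
qed

lemma unit_cells_copy:
  assumes "unit_cells \<pi>" "p < q"
  shows "finite (homothetic_copy \<pi> p q)"
    and "\<And>u v. (u, v) \<in> homothetic_copy \<pi> p q \<Longrightarrow> p < v \<and> v \<le> q"
proof -
  show "finite (homothetic_copy \<pi> p q)"
    using assms by (simp add: unit_cells_def homothetic_copy_def)
  fix u v assume "(u, v) \<in> homothetic_copy \<pi> p q"
  then obtain c d where cd: "(c, d) \<in> \<pi>" "v = p + (q - p) * d"
    by (auto simp: homothetic_copy_def)
  with assms have "0 < d" "d \<le> 1" by (auto simp: unit_cells_def)
  then show "p < v \<and> v \<le> q"
    using affine_between[OF assms(2)] cd(2) by blast
qed

lemma inj_on_copy: "p < q \<Longrightarrow> inj_on (\<lambda>(c, d). (p + (q - p) * c, p + (q - p) * d)) A"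
  for p q :: real
  by (auto simp: inj_on_def)

lemma card_homothetic_copy: "p < q \<Longrightarrow> card (homothetic_copy \<pi> p q) = card \<pi>"
  unfolding homothetic_copy_def by (rule card_image) (rule inj_on_copy)

lemma count_below_copy:
  assumes "p < q"
  shows "count_below (homothetic_copy \<pi> p q) (p + (q - p) * x) = count_below \<pi> x"
proof -
  have "{r \<in> homothetic_copy \<pi> p q. snd r < p + (q - p) * x} =
      homothetic_copy {r \<in> \<pi>. snd r < x} p q"
    using assms by (auto simp: homothetic_copy_def)
  then show ?thesis
    using assms by (simp add: count_below_def card_homothetic_copy)
qed

lemma count_below_all:
  assumes "\<And>u v. (u, v) \<in> \<pi> \<Longrightarrow> v < x"
  shows "count_below \<pi> x = card \<pi>"
proof -
  have "{p \<in> \<pi>. snd p < x} = \<pi>" using assms by auto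
  then show ?thesis by (simp add: count_below_def)
qed

lemma count_below_none:
  assumes "\<And>u v. (u, v) \<in> \<pi> \<Longrightarrow> x \<le> v"
  shows "count_below \<pi> x = 0"
proof -
  have "{p \<in> \<pi>. snd p < x} = {}" using assms by (force simp: not_less)
  then show ?thesis by (simp only: count_below_def card.empty)
qed

text \<open>The cells \<open>[e k, e (k + 1)[\<close>, \<open>k < m\<close>, carry homothetic copies of the partitions \<open>A k\<close>.\<close>

locale tiling =
  fixes m :: nat and e :: "nat \<Rightarrow> real" and A :: "nat \<Rightarrow> partition"
  assumes e_step: "\<And>k. e k < e (Suc k)"
    and e_0: "e 0 = 0" and e_m: "e m = 1"
    and cells: "\<And>k. unit_cells (A k)"
begin

definition tile :: "nat \<Rightarrow> partition" where
  "tile k = homothetic_copy (A k) (e k) (e (Suc k))"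

definition whole :: partition where
  "whole = (\<Union>k<m. tile k)"

lemma e_mono: "i \<le> j \<Longrightarrow> e i \<le> e j"
  by (rule lift_Suc_mono_le) (use e_step less_imp_le in auto)

lemma finite_tile: "finite (tile k)"
  unfolding tile_def by (rule unit_cells_copy(1)[OF cells e_step])

lemma tile_snd: "(u, v) \<in> tile k \<Longrightarrow> e k < v \<and> v \<le> e (Suc k)"
  unfolding tile_def by (rule unit_cells_copy(2)[OF cells e_step])

lemma card_tile: "card (tile k) = card (A k)"
  unfolding tile_def by (rule card_homothetic_copy[OF e_step])

lemma tile_disjoint:
  assumes "i \<noteq> j" shows "tile i \<inter> tile j = {}"
proof -
  have *: "tile i \<inter> tile j = {}" if "i < j" for i j
  proof -
    have "e (Suc i) \<le> e j" using that by (intro e_mono) simp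
    then show ?thesis using tile_snd[of _ _ i] tile_snd[of _ _ j] by fastforce
  qed
  show ?thesis using assms *[of i j] *[of j i] by (cases "i < j") auto
qed

lemma unit_cells_whole: "unit_cells whole"
  unfolding unit_cells_def
proof (intro conjI ballI)
  show "finite whole" by (simp add: whole_def finite_tile)
  fix p assume "p \<in> whole"
  then obtain k where k: "k < m" "p \<in> tile k" by (auto simp: whole_def)
  then show "case p of (u, v) \<Rightarrow> 0 < v \<and> v \<le> 1"
    using tile_snd[of "fst p" "snd p" k] e_mono[of 0 k] e_mono[of "Suc k" m] e_0 e_m
    by (auto simp: case_prod_beta)
qed

lemma card_whole: "card whole = (\<Sum>k<m. card (A k))"
  unfolding whole_def
  by (subst card_UN_disjoint) (auto simp: finite_tile card_tile tile_disjoint)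

text \<open>Tiles left of cell \<open>k\<close> are counted in full, those to its right not at all.
  With \<open>x\<close> in \<open>]0,1]\<close> a boundary point is addressed as the right end of a
  cell; at \<open>x = 0\<close> a right endpoint equal to \<open>e k\<close> in the previous tile
  would be missed.\<close>

lemma count_below_whole:
  assumes k: "k < m" and x: "0 < x" "x \<le> 1"
  shows "count_below whole (e k + (e (Suc k) - e k) * x) =
    (\<Sum>i<k. card (A i)) + count_below (A k) x"
proof -
  define X where "X = e k + (e (Suc k) - e k) * x"
  have X: "e k < X" "X \<le> e (Suc k)"
    unfolding X_def by (rule affine_between[OF e_step x])+
  have lt: "count_below (tile i) X = card (A i)" if "i < k" for i
  proof -
    have "count_below (tile i) X = card (tile i)"
    proof (rule count_below_all)
      fix u v assume "(u, v) \<in> tile i"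
      then show "v < X" using tile_snd e_mono[of "Suc i" k] that X by force
    qed
    then show ?thesis by (simp add: card_tile)
  qed
  have gt: "count_below (tile i) X = 0" if "k < i" for i
  proof (rule count_below_none)
    fix u v assume "(u, v) \<in> tile i"
    then show "X \<le> v" using tile_snd e_mono[of "Suc k" i] that X by force
  qed
  have "{p \<in> whole. snd p < X} = (\<Union>i<m. {p \<in> tile i. snd p < X})"
    by (auto simp: whole_def)
  then have "count_below whole X = (\<Sum>i<m. count_below (tile i) X)"
    unfolding count_below_def
    by (simp only:, subst card_UN_disjoint) (use tile_disjoint finite_tile in auto)
  also have "\<dots> = (\<Sum>i<Suc k. count_below (tile i) X)"
    by (rule sum.mono_neutral_right) (use k gt in auto)
  also have "\<dots> = (\<Sum>i<k. card (A i)) + count_below (tile k) X"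
    using lt by simp
  also have "count_below (tile k) X = count_below (A k) x"
    unfolding tile_def X_def by (rule count_below_copy[OF e_step])
  finally show ?thesis by (simp add: X_def)
qed

lemma tile_cases:
  assumes "0 < x" "x \<le> 1"
  obtains k y where "k < m" "0 < y" "y \<le> 1" "x = e k + (e (Suc k) - e k) * y"
proof -
  have ex: "x \<le> e m" using assms e_m by simp
  \<comment> \<open>The least index selects the cell \<open>]e k, e (Suc k)]\<close> around
    \<open>x\<close>, closed on the right.\<close>
  define j where "j = (LEAST j. x \<le> e j)"
  have j: "x \<le> e j" "j \<le> m" unfolding j_def using ex by (auto intro: LeastI Least_le)
  have "j \<noteq> 0" using j assms e_0 by (intro notI) auto
  then obtain k where k: "j = Suc k" using not0_implies_Suc by blast
  have "\<not> x \<le> e k"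
    using not_less_Least[of k "\<lambda>j. x \<le> e j"] k by (simp add: j_def)
  then show ?thesis
    using that[of k "(x - e k) / (e (Suc k) - e k)"] j k e_step[of k] by auto
qed

end

section \<open>The \<open>LS\<close> partitions, built from the outside\<close>

locale LS_parameters =
  fixes L S :: nat and \<beta> :: real
  assumes L: "1 \<le> L" and S: "1 \<le> S" and \<beta>: "0 < \<beta>" "\<beta> < 1"
    and LS: "real L * \<beta> + real S * \<beta>^2 = 1"
begin

text \<open>The value at \<open>L + S\<close> is 1, and the sequence continues beyond it in steps
  \<open>\<beta>^2\<close>, because \<open>tiling\<close> asks for strict growth at every
  index.\<close>

definition endpt :: "nat \<Rightarrow> real" where
  "endpt k = (if k \<le> L then real k * \<beta> else real L * \<beta> + real (k - L) * \<beta>^2)"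

lemma endpt_long: "k \<le> L \<Longrightarrow> endpt k = real k * \<beta>"
  by (simp add: endpt_def)

lemma endpt_short: "L \<le> k \<Longrightarrow> endpt k = real L * \<beta> + real (k - L) * \<beta>^2"
  by (simp add: endpt_def)

lemma width_long: "k < L \<Longrightarrow> endpt (Suc k) - endpt k = \<beta>"
  by (simp add: endpt_long algebra_simps)

lemma width_short: "L \<le> k \<Longrightarrow> endpt (Suc k) - endpt k = \<beta>^2"
  by (simp add: endpt_short Suc_diff_le algebra_simps)

lemma endpt_step: "endpt k < endpt (Suc k)"
  using width_long[of k] width_short[of k] \<beta> zero_less_power[of \<beta> 2]
  by (cases "k < L") linarith+

text \<open>The same partitions generated from the outside: the first refinement is applied last.
  The index is shifted by one, so that both initial values are trivial.\<close>

fun Q :: "nat \<Rightarrow> partition" where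
  "Q 0 = {(0, 1)}"
| "Q (Suc 0) = {(0, 1)}"
| "Q (Suc (Suc n)) = (\<Union>k<L + S.
     homothetic_copy (if k < L then Q (Suc n) else Q n) (endpt k) (endpt (Suc k)))"

lemma rho_LS_eq: "rho_LS L S \<beta> = (\<Union>k<L + S. {(endpt k, endpt (Suc k))})"
proof -
  have split: "{..<L + S} = {..<L} \<union> (\<lambda>j. L + j) ` {..<S}"
  proof (intro equalityI subsetI)
    fix k assume "k \<in> {..<L + S}"
    then show "k \<in> {..<L} \<union> (\<lambda>j. L + j) ` {..<S}"
      by (cases "k < L") (auto intro!: image_eqI[of _ _ "k - L"])
  qed auto
  have "(\<lambda>i. (endpt i, endpt (Suc i))) ` {..<L} =
      (\<lambda>i. (real i * \<beta>, real (i + 1) * \<beta>)) ` {..<L}"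
    by (rule image_cong) (auto simp: endpt_long)
  moreover have "(\<lambda>j. (endpt (L + j), endpt (Suc (L + j)))) ` {..<S} =
      (\<lambda>j. (real L * \<beta> + real j * \<beta>^2, real L * \<beta> + real (j + 1) * \<beta>^2)) ` {..<S}"
    by (rule image_cong) (auto simp: endpt_short Suc_diff_le)
  moreover have "(\<Union>k<L + S. {(endpt k, endpt (Suc k))}) =
      (\<lambda>k. (endpt k, endpt (Suc k))) ` {..<L + S}" by auto
  ultimately show ?thesis
    unfolding rho_LS_def split image_Un image_image by simp
qed

text \<open>The quotient keeps \<open>n = 0\<close> uniform: the length \<open>1 / \<beta>\<close>
  exceeds 1, so nothing is split and \<open>Q 0 = Q 1\<close>. In the induction step the widths
  \<open>\<beta>\<close> and \<open>\<beta>^2\<close> scale the lengths belonging to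
  \<open>Q (Suc n)\<close> and \<open>Q n\<close> to one common length.\<close>

lemma refine_at_Q: "refine_at (rho_LS L S \<beta>) (\<beta>^n / \<beta>) (Q n) = Q (Suc n)"
proof (induction n rule: Q.induct)
  case 1
  then show ?case using \<beta> by (auto simp: refine_at_def)
next
  case 2
  have "Q (Suc (Suc 0)) = rho_LS L S \<beta>"
    unfolding rho_LS_eq Q.simps(3) by (intro SUP_cong refl) simp
  then show ?case using \<beta> by (simp add: refine_at_def del: Q.simps(3))
next
  case (3 n)
  have "refine_at (rho_LS L S \<beta>) (\<beta>^(Suc (Suc n)) / \<beta>)
      (homothetic_copy (if k < L then Q (Suc n) else Q n) (endpt k) (endpt (Suc k))) =
      homothetic_copy (if k < L then Q (Suc (Suc n)) else Q (Suc n)) (endpt k) (endpt (Suc k))"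
    if "k < L + S" for k
  proof (cases "k < L")
    case True
    have "\<beta>^(Suc (Suc n)) / \<beta> = (endpt (Suc k) - endpt k) * (\<beta>^(Suc n) / \<beta>)"
      using width_long[OF True] by simp
    then show ?thesis
      using refine_at_copy[OF endpt_step, of "rho_LS L S \<beta>" k "\<beta>^(Suc n) / \<beta>"] 3(1)[of k] that True
      by (simp only: if_True lessThan_iff simp_thms)
  next
    case False
    have "\<beta>^(Suc (Suc n)) / \<beta> = (endpt (Suc k) - endpt k) * (\<beta>^n / \<beta>)"
      using width_short[of k] False by (simp add: power2_eq_square)
    then show ?thesis
      using refine_at_copy[OF endpt_step, of "rho_LS L S \<beta>" k "\<beta>^n / \<beta>"] 3(2)[of k] that False
      by (simp only: if_False lessThan_iff simp_thms)
  qed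
  then show ?case
    unfolding Q.simps(3)[of n] Q.simps(3)[of "Suc n"] refine_at_UN
    by (intro SUP_cong refl) (auto simp del: Q.simps power_Suc)
qed

lemma Q_length_le: "(u, v) \<in> Q n \<Longrightarrow> v - u \<le> \<beta>^n / \<beta>"
proof (induction n arbitrary: u v rule: Q.induct)
  case (3 n)
  from 3(3) obtain k where k: "k < L + S"
    "(u, v) \<in> homothetic_copy (if k < L then Q (Suc n) else Q n) (endpt k) (endpt (Suc k))"
    by auto
  then obtain c d where cd: "(c, d) \<in> (if k < L then Q (Suc n) else Q n)"
    "u = endpt k + (endpt (Suc k) - endpt k) * c"
    "v = endpt k + (endpt (Suc k) - endpt k) * d"
    by (auto simp: homothetic_copy_def)
  have uv: "v - u = (endpt (Suc k) - endpt k) * (d - c)"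
    unfolding cd by (simp add: algebra_simps)
  show ?case
  proof (cases "k < L")
    case True
    then have "d - c \<le> \<beta>^Suc n / \<beta>" using 3(1)[of k c d] k cd by simp
    then have "\<beta> * (d - c) \<le> \<beta> * (\<beta>^Suc n / \<beta>)" using \<beta> by (intro mult_left_mono) auto
    then show ?thesis using uv width_long[OF True] \<beta> by simp
  next
    case False
    then have "d - c \<le> \<beta>^n / \<beta>" using 3(2)[of k c d] k cd by simp
    then have "\<beta>^2 * (d - c) \<le> \<beta>^2 * (\<beta>^n / \<beta>)" using \<beta> by (intro mult_left_mono) auto
    then show ?thesis using uv width_short[of k] False by (simp add: power2_eq_square)
  qed
qed (use \<beta> in auto)

text \<open>Since \<open>L \<ge> 1\<close>, the first cell is long and holds the previous partition
  scaled by \<open>\<beta>\<close>, together with its longest interval.\<close>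

lemma Q_long_cell: "\<exists>u v. (u, v) \<in> Q (Suc n) \<and> v - u = \<beta>^n"
proof (induction n)
  case 0
  show ?case by auto
next
  case (Suc n)
  then obtain u v where uv: "(u, v) \<in> Q (Suc n)" "v - u = \<beta>^n" by auto
  have w: "endpt (Suc 0) - endpt 0 = \<beta>" using width_long[of 0] L by simp
  have "(\<beta> * u, \<beta> * v) \<in> homothetic_copy (Q (Suc n)) (endpt 0) (endpt (Suc 0))"
    unfolding homothetic_copy_def w using uv(1) by (force simp: endpt_def)
  then have "(\<beta> * u, \<beta> * v) \<in> Q (Suc (Suc n))" using L by (auto intro!: bexI[of _ 0])
  moreover have "\<beta> * v - \<beta> * u = \<beta>^Suc n" using uv(2) by (simp flip: right_diff_distrib)
  ultimately show ?case by blast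
qed

text \<open>The two facts are interlocked: a tiling needs its pieces to be
  \<open>unit_cells\<close>, and the glued partition inherits this property from the tiling.\<close>

lemma unit_cells_Q: "unit_cells (Q n)"
  and tiling_step: "tiling (L + S) endpt (\<lambda>k. if k < L then Q (Suc n) else Q n)"
proof -
  have step: "tiling (L + S) endpt (\<lambda>k. if k < L then Q (Suc n) else Q n)"
    if "unit_cells (Q (Suc n))" "unit_cells (Q n)" for n
    using that endpt_step LS S by unfold_locales (auto simp: endpt_def)
  have *: "unit_cells (Q n)" for n
  proof (induction n rule: Q.induct)
    case (3 n)
    \<comment> \<open>The induction rule of \<open>Q\<close> states its hypotheses per index
      \<open>k\<close>; the indices \<open>0\<close> and \<open>L\<close> pick a long and a short
      cell.\<close>
    have 4: "unit_cells (Q (Suc n))" "unit_cells (Q n)"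
      using 3(1)[of 0] 3(2)[of L] L S by auto
    show ?case
      using tiling.unit_cells_whole[OF step[OF 4]]
      by (simp add: tiling.whole_def[OF step[OF 4]] tiling.tile_def[OF step[OF 4]])
  qed (auto simp: unit_cells_def)
  show "unit_cells (Q n)" by (rule *)
  show "tiling (L + S) endpt (\<lambda>k. if k < L then Q (Suc n) else Q n)" by (rule step[OF * *])
qed

lemma finite_Q: "finite (Q n)"
  using unit_cells_Q by (simp add: unit_cells_def)

lemma max_length_Q: "max_length (Q (Suc n)) = \<beta>^n"
  unfolding max_length_def
proof (rule Max_eqI)
  show "finite ((\<lambda>(u, v). v - u) ` Q (Suc n))" using finite_Q by blast
  show "\<beta>^n \<in> (\<lambda>(u, v). v - u) ` Q (Suc n)" using Q_long_cell[of n] by force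
  fix y assume "y \<in> (\<lambda>(u, v). v - u) ` Q (Suc n)"
  then show "y \<le> \<beta>^n" using Q_length_le[of _ _ "Suc n"] \<beta> by auto
qed

lemma LS_partition_eq: "LS_partition L S \<beta> n = Q (Suc n)"
proof (induction n)
  case 0
  show ?case by (simp add: LS_partition_def trivial_partition_def)
next
  case (Suc n)
  have "LS_partition L S \<beta> (Suc n) = refine_at (rho_LS L S \<beta>) (\<beta>^n) (Q (Suc n))"
    using Suc by (simp add: LS_partition_def refinement_eq_refine_at max_length_Q del: Q.simps)
  then show ?case using refine_at_Q[of "Suc n"] \<beta> by (simp del: Q.simps)
qed

section \<open>Interval counts, defects and the counting error\<close>

definition T :: "nat \<Rightarrow> real" where "T n = real (card (Q n))"

definition E :: "nat \<Rightarrow> real \<Rightarrow> real" where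
  "E n x = real (count_below (Q n) x) - x * T n"

text \<open>A long cell of \<open>Q (Suc (Suc n))\<close> holds \<open>T (Suc n)\<close> intervals,
  which exceeds its share by length by \<open>\<delta> (Suc n)\<close>. For a short cell the surplus
  is \<open>\<delta> n + \<beta> * \<delta> (Suc n)\<close>.\<close>

definition \<delta> :: "nat \<Rightarrow> real" where "\<delta> n = T n - \<beta> * T (Suc n)"

lemma Q_eq_whole: "Q (Suc (Suc n)) = tiling.whole (L + S) endpt (\<lambda>k. if k < L then Q (Suc n) else Q n)"
  by (simp add: tiling.whole_def[OF tiling_step] tiling.tile_def[OF tiling_step])

lemma sum_card_Q:
  "real (\<Sum>i<k. card (if i < L then Q (Suc n) else Q n)) =
    (if k \<le> L then real k * T (Suc n) else real L * T (Suc n) + real (k - L) * T n)"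
proof (induction k)
  case (Suc k)
  consider "Suc k \<le> L" | "k = L" | "L < k" by linarith
  then show ?case
    using Suc by cases (simp_all add: T_def algebra_simps Suc_diff_le del: Q.simps)
qed simp

lemma T_0 [simp]: "T 0 = 1" and T_1 [simp]: "T (Suc 0) = 1"
  by (simp_all add: T_def)

lemma T_rec: "T (Suc (Suc n)) = real L * T (Suc n) + real S * T n"
proof -
  have "T (Suc (Suc n)) = real (\<Sum>i<L + S. card (if i < L then Q (Suc n) else Q n))"
    unfolding T_def Q_eq_whole tiling.card_whole[OF tiling_step] ..
  then show ?thesis using S by (simp only: sum_card_Q) simp
qed

text \<open>The numbers \<open>T n * \<beta>^n\<close> start with 1 and \<open>\<beta>\<close>, and
  each later one is a convex combination of the two before it, with weights
  \<open>L * \<beta>\<close> and \<open>S * \<beta>^2\<close>.\<close>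

lemma T_bounds: "\<beta> \<le> T n * \<beta>^n \<and> T n * \<beta>^n \<le> 1"
proof (induction n rule: Q.induct)
  case (3 n)
  have IH: "\<beta> \<le> T (Suc n) * \<beta>^Suc n" "T (Suc n) * \<beta>^Suc n \<le> 1" "\<beta> \<le> T n * \<beta>^n" "T n * \<beta>^n \<le> 1"
    using 3(1)[of 0] 3(2)[of L] L S by auto
  define a b where "a = real L * \<beta>" and "b = real S * \<beta>^2"
  have ab: "0 \<le> a" "0 \<le> b" "a + b = 1" using \<beta> LS by (auto simp: a_def b_def)
  have eq: "T (Suc (Suc n)) * \<beta>^Suc (Suc n) = a * (T (Suc n) * \<beta>^Suc n) + b * (T n * \<beta>^n)"
    by (simp add: T_rec a_def b_def algebra_simps power2_eq_square)
  have "\<beta> = a * \<beta> + b * \<beta>" "1 = a * 1 + b * 1" using ab by (simp_all flip: distrib_right)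
  then show ?case unfolding eq using ab IH
    by (metis add_mono mult_left_mono)
qed (use \<beta> in auto)

text \<open>The recursion for \<open>T\<close> has characteristic roots \<open>1 / \<beta>\<close>
  and \<open>- S * \<beta>\<close>; forming \<open>\<delta>\<close> cancels the first.\<close>

lemma \<delta>_eq: "\<delta> n = (1 - \<beta>) * (- (real S * \<beta>))^n"
proof (induction n)
  case (Suc n)
  have "\<delta> (Suc n) = (1 - real L * \<beta>) * T (Suc n) - \<beta> * real S * T n"
    by (simp add: \<delta>_def T_rec algebra_simps)
  also have "1 - real L * \<beta> = real S * \<beta>^2" using LS by simp
  finally have "\<delta> (Suc n) = - (real S * \<beta>) * \<delta> n"
    by (simp add: \<delta>_def algebra_simps power2_eq_square)
  then show ?case using Suc by simp
qed (simp add: \<delta>_def)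

lemma abs_\<delta>: "\<bar>\<delta> n\<bar> = (1 - \<beta>) * (real S * \<beta>)^n"
  using \<beta> by (simp add: \<delta>_eq abs_mult power_abs)

text \<open>The error at a point of cell \<open>k\<close> is the error of the piece placed there,
  plus the surpluses of all cells on the left, plus the fraction \<open>x\<close> of the surplus of
  the cell itself.\<close>

lemma E_tile:
  assumes "k < L + S" "0 < x" "x \<le> 1"
  shows "E (Suc (Suc n)) (endpt k + (endpt (Suc k) - endpt k) * x) =
    (if k < L then E (Suc n) x + (real k + x) * \<delta> (Suc n)
     else E n x + real L * \<delta> (Suc n) + (real (k - L) + x) * (\<delta> n + \<beta> * \<delta> (Suc n)))"
proof -
  have "real (count_below (Q (Suc (Suc n))) (endpt k + (endpt (Suc k) - endpt k) * x)) =
    real (\<Sum>i<k. card (if i < L then Q (Suc n) else Q n)) +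
    real (count_below (if k < L then Q (Suc n) else Q n) x)"
    unfolding Q_eq_whole tiling.count_below_whole[OF tiling_step assms] by simp
  then have eq: "E (Suc (Suc n)) (endpt k + (endpt (Suc k) - endpt k) * x) =
    (if k \<le> L then real k * T (Suc n) else real L * T (Suc n) + real (k - L) * T n)
     + real (count_below (if k < L then Q (Suc n) else Q n) x)
     - (endpt k + (endpt (Suc k) - endpt k) * x) * T (Suc (Suc n))"
    by (simp only: E_def sum_card_Q)
  show ?thesis
  proof (cases "k < L")
    case True
    then show ?thesis unfolding eq unfolding width_long[OF True]
      by (simp add: endpt_long E_def \<delta>_def algebra_simps del: Q.simps)
  next
    case False
    then have w: "endpt (Suc k) - endpt k = \<beta>^2" by (simp add: width_short)
    have "(if k \<le> L then real k * T (Suc n) else real L * T (Suc n) + real (k - L) * T n) =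
      real L * T (Suc n) + real (k - L) * T n" using False by (cases "k = L") auto
    then show ?thesis unfolding eq unfolding w using False
      by (simp add: endpt_short E_def \<delta>_def algebra_simps power2_eq_square del: Q.simps)
  qed
qed

lemma E_init:
  assumes "x \<le> 1" shows "E 0 x = - x" "E (Suc 0) x = - x"
  using count_below_none[of "{(0, 1)}" x] assms by (auto simp: E_def)

lemma E_0 [simp]: "E n 0 = 0"
proof -
  have "count_below (Q n) 0 = 0"
    by (rule count_below_none) (use unit_cells_Q[of n] in \<open>force simp: unit_cells_def\<close>)
  then show ?thesis by (simp add: E_def)
qed

text \<open>Only the right endpoint 1 escapes the strict count. The induction descends into the last
  cell; the surpluses of all \<open>L + S\<close> cells cancel by the equation for
  \<open>\<beta>\<close>.\<close>

lemma E_1: "E n 1 = -1"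
proof (induction n rule: Q.induct)
  case (3 n)
  define k where "k = L + S - 1"
  have k: "k < L + S" "\<not> k < L" "Suc k = L + S" "real (k - L) = real S - 1"
    using S by (auto simp: k_def of_nat_diff)
  have 1: "endpt k + (endpt (Suc k) - endpt k) * 1 = 1"
    using k(3) LS S by (simp add: endpt_def)
  have "E n 1 = -1" using 3(2)[of k] k by simp
  then have "E (Suc (Suc n)) 1 = -1 + real L * \<delta> (Suc n) + real S * (\<delta> n + \<beta> * \<delta> (Suc n))"
    using E_tile[OF k(1), of 1 n, unfolded 1] k by simp
  also have "\<dots> = -1 + (real L * \<beta> + real S * \<beta>^2 - 1) * (- (real S)) * ((1 - \<beta>) * (- (real S * \<beta>))^n)"
    by (simp add: \<delta>_eq algebra_simps power2_eq_square)
  also have "\<dots> = -1" using LS by simp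
  finally show ?case .
qed (simp_all add: E_init)

lemma E_bound:
  assumes "0 \<le> x" "x \<le> 1"
  shows "\<bar>E n x\<bar> \<le> 1 + (real L + 2 * real S) * (\<Sum>k<n. (real S * \<beta>)^k)"
proof -
  define C where "C = real L + 2 * real S"
  define q where "q = real S * \<beta>"
  have q: "0 \<le> q" using \<beta> by (simp add: q_def)
  have C: "0 \<le> C" by (simp add: C_def)
  have \<delta>: "\<bar>\<delta> n\<bar> \<le> q^n" for n
    using abs_\<delta>[of n] \<beta> q mult_right_mono[of "1 - \<beta>" 1 "q^n"] by (simp add: q_def)
  have "\<bar>E n x\<bar> \<le> 1 + C * (\<Sum>k<n. q^k)" if "0 < x" "x \<le> 1" for x
    using that
  proof (induction n arbitrary: x rule: Q.induct)
    case (3 n)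
    obtain k y where k: "k < L + S" and y: "0 < y" "y \<le> 1"
      and x: "x = endpt k + (endpt (Suc k) - endpt k) * y"
      by (rule tiling.tile_cases[OF tiling_step[of n] 3(3,4)])
    show ?case
    proof (cases "k < L")
      case True
      have ky: "0 \<le> real k + y" "real k + y \<le> C" using True y by (auto simp: C_def)
      have "\<bar>(real k + y) * \<delta> (Suc n)\<bar> \<le> C * q^Suc n"
        unfolding abs_mult using ky \<delta>[of "Suc n"] by (intro mult_mono) auto
      moreover have "\<bar>E (Suc n) y\<bar> \<le> 1 + C * (\<Sum>k<Suc n. q^k)"
        using 3(1)[of k y] k True y by simp
      moreover have "E (Suc (Suc n)) x = E (Suc n) y + (real k + y) * \<delta> (Suc n)"
        using E_tile[OF k y] True x by simp
      ultimately show ?thesis by (simp add: distrib_left)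
    next
      case False
      have ky: "0 \<le> real (k - L) + y" "real (k - L) + y \<le> real S" using k False y by auto
      have \<beta>\<delta>: "\<bar>\<delta> n + \<beta> * \<delta> (Suc n)\<bar> \<le> q^n + q^Suc n"
      proof -
        have "\<bar>\<beta> * \<delta> (Suc n)\<bar> \<le> 1 * q^Suc n"
          unfolding abs_mult using \<beta> \<delta>[of "Suc n"] by (intro mult_mono) auto
        then show ?thesis using \<delta>[of n] by simp
      qed
      have "\<bar>(real (k - L) + y) * (\<delta> n + \<beta> * \<delta> (Suc n))\<bar> \<le> real S * (q^n + q^Suc n)"
        unfolding abs_mult using ky \<beta>\<delta> by (intro mult_mono) auto
      moreover have "\<bar>real L * \<delta> (Suc n)\<bar> \<le> real L * q^Suc n"
        unfolding abs_mult using \<delta>[of "Suc n"] by (intro mult_mono) auto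
      moreover have "\<bar>E n y\<bar> \<le> 1 + C * (\<Sum>k<n. q^k)"
        using 3(2)[of k y] k False y by simp
      moreover have "E (Suc (Suc n)) x =
          E n y + real L * \<delta> (Suc n) + (real (k - L) + y) * (\<delta> n + \<beta> * \<delta> (Suc n))"
        using E_tile[OF k y] False x by simp
      moreover have "real S * (q^n + q^Suc n) + real L * q^Suc n \<le> C * (q^n + q^Suc n)"
        using q by (simp add: C_def algebra_simps)
      \<comment> \<open>A short cell descends two levels at once, which makes two terms of the sum
        available for its contribution.\<close>
      moreover have "1 + C * (\<Sum>k<Suc (Suc n). q^k) = 1 + C * (\<Sum>k<n. q^k) + C * (q^n + q^Suc n)"
        by (simp add: algebra_simps)
      ultimately show ?thesis by linarith
    qed
  qed (use C in \<open>auto simp: E_init\<close>)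
  \<comment> \<open>For \<open>x = 0\<close>, which lies in no cell closed on the right only; there
    the error vanishes.\<close>
  moreover have "0 \<le> C * (\<Sum>k<n. q^k)" using C q by (intro mult_nonneg_nonneg sum_nonneg) auto
  ultimately show ?thesis
    using assms by (cases "x = 0") (auto simp: C_def q_def)
qed

text \<open>The point \<open>\<beta>\<close> is the right end of the first long cell, so a single
  defect survives; it dominates when \<open>S * \<beta> > 1\<close>.\<close>

lemma E_at_\<beta>: "E (Suc (Suc n)) \<beta> = -1 + \<delta> (Suc n)"
  using E_tile[of 0 1 n] L E_1 by (simp add: endpt_def)

text \<open>Descending into the first short cell lets the \<open>L\<close> long cells on its left contribute errors
  of the same sign at every second level.\<close>

lemma E_large:
  assumes "real S * \<beta> = 1"
  shows "\<exists>x. 0 < x \<and> x \<le> 1 \<and> (1 - \<beta>) * \<beta> * real (n div 2) - 1 \<le> (-1)^Suc n * E n x"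
proof (induction n rule: Q.induct)
  case (3 n)
  obtain x where x: "0 < x" "x \<le> 1"
    and IH: "(1 - \<beta>) * \<beta> * real (n div 2) - 1 \<le> (-1)^Suc n * E n x"
    using 3(2)[of L] S by auto
  define X where "X = endpt L + (endpt (Suc L) - endpt L) * x"
  have k: "L < L + S" using S by simp
  have eq: "E (Suc (Suc n)) X = E n x + real L * \<delta> (Suc n) + x * (\<delta> n + \<beta> * \<delta> (Suc n))"
    unfolding X_def E_tile[OF k x] by simp
  have sgn: "(-1)^Suc n * \<delta> n = - (1 - \<beta>)" "(-1)^Suc n * \<delta> (Suc n) = 1 - \<beta>"
    by (cases "even n"; simp add: \<delta>_eq assms)+
  have "(-1)^Suc (Suc (Suc n)) * E (Suc (Suc n)) X =
      (-1)^Suc n * E n x + real L * ((-1)^Suc n * \<delta> (Suc n)) +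
      x * ((-1)^Suc n * \<delta> n + \<beta> * ((-1)^Suc n * \<delta> (Suc n)))"
    unfolding eq by (simp add: algebra_simps)
  also have "\<dots> = (-1)^Suc n * E n x + (1 - \<beta>) * (real L - x * (1 - \<beta>))"
    unfolding sgn by (simp add: algebra_simps)
  finally have EX: "(-1)^Suc (Suc (Suc n)) * E (Suc (Suc n)) X =
    (-1)^Suc n * E n x + (1 - \<beta>) * (real L - x * (1 - \<beta>))" .
  \<comment> \<open>The gain per two levels is at least \<open>(1 - \<beta>) * \<beta>\<close>, as
    \<open>L \<ge> 1\<close> and \<open>x \<le> 1\<close>.\<close>
  have "x * (1 - \<beta>) \<le> 1 * (1 - \<beta>)" using x \<beta> by (intro mult_right_mono) auto
  then have "\<beta> \<le> real L - x * (1 - \<beta>)" using L by simp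
  then have "(1 - \<beta>) * \<beta> \<le> (1 - \<beta>) * (real L - x * (1 - \<beta>))"
    using \<beta> by (intro mult_left_mono) auto
  then have "(1 - \<beta>) * \<beta> * real (Suc (Suc n) div 2) - 1 \<le>
      (-1)^Suc (Suc (Suc n)) * E (Suc (Suc n)) X"
    using EX IH by (simp add: algebra_simps)
  moreover have "0 < X \<and> X \<le> 1"
  proof -
    have X: "X = real L * \<beta> + \<beta>^2 * x" by (simp add: X_def endpt_def algebra_simps)
    have "x * \<beta>^2 \<le> real S * \<beta>^2" using x S by (intro mult_right_mono) auto
    then have "X \<le> 1" unfolding X using LS by (simp add: mult.commute)
    moreover have "0 < X" unfolding X using x \<beta> L by (intro add_pos_pos) auto
    ultimately show ?thesis by simp
  qed
  ultimately show ?case by blast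
\<comment> \<open>The witness is 1 at both initial levels; the \<open>- 1\<close> in the bound is
  attained at \<open>n = 1\<close>.\<close>
qed (auto simp: E_init intro!: exI[of _ 1])

section \<open>From the counting error to the discrepancy\<close>

lemma sum_indicator_Q:
  assumes "a < b"
  shows "(\<Sum>(u, y)\<in>Q n. indicator {a..<b} y) =
    real (count_below (Q n) b) - real (count_below (Q n) a)"
proof -
  have c: "real (count_below (Q n) x) = (\<Sum>p\<in>Q n. if snd p < x then 1 else 0)" for x
    by (simp add: count_below_def finite_Q Int_def flip: sum.inter_filter)
  show ?thesis
    unfolding c sum_subtractf[symmetric]
    by (rule sum.cong) (use assms in \<open>auto simp: indicator_def\<close>)
qed

lemma T_pos: "0 < T n"
  using T_bounds[of n] \<beta> by (metis less_le_trans zero_less_mult_pos2 zero_less_power)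

lemma discrepancy_Q:
  "discrepancy (Q n) = (SUP (a, b)\<in>{(a, b). 0 \<le> a \<and> a < b \<and> b \<le> 1}. \<bar>E n b - E n a\<bar> / T n)"
  unfolding discrepancy_def
proof (intro SUP_cong refl, clarify)
  fix a b :: real assume "a < b"
  have "1 / real (card (Q n)) * (\<Sum>(u, y)\<in>Q n. indicator {a..<b} y) - (b - a) =
      (E n b - E n a) / T n"
    unfolding sum_indicator_Q[OF \<open>a < b\<close>] using T_pos[of n] by (simp add: E_def T_def field_simps)
  then show "\<bar>1 / real (card (Q n)) * (\<Sum>(u, y)\<in>Q n. indicator {a..<b} y) - (b - a)\<bar> =
      \<bar>E n b - E n a\<bar> / T n"
    using T_pos[of n] by simp
qed

text \<open>Serves twice: as the upper estimate, and as the boundedness that lets single intervals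
  bound the supremum from below.\<close>

lemma abs_E_diff_le:
  assumes "0 \<le> a" "a \<le> 1" "0 \<le> b" "b \<le> 1"
  shows "\<bar>E n b - E n a\<bar> / T n \<le> 2 * (1 + (real L + 2 * real S) * (\<Sum>k<n. (real S * \<beta>)^k)) / T n"
  using E_bound[of a n] E_bound[of b n] assms T_pos[of n] by (intro divide_right_mono) auto

lemma discrepancy_upper:
  "discrepancy (Q n) * T n \<le> 2 * (1 + (real L + 2 * real S) * (\<Sum>k<n. (real S * \<beta>)^k))"
proof -
  have "discrepancy (Q n) \<le> 2 * (1 + (real L + 2 * real S) * (\<Sum>k<n. (real S * \<beta>)^k)) / T n"
    unfolding discrepancy_Q
  proof (rule cSUP_least)
    have "(0, 1) \<in> {(a, b). 0 \<le> a \<and> a < b \<and> b \<le> (1::real)}" by simp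
    then show "{(a, b). 0 \<le> a \<and> a < b \<and> b \<le> (1::real)} \<noteq> {}" by blast
  qed (use abs_E_diff_le in auto)
  then show ?thesis by (simp only: pos_le_divide_eq[OF T_pos])
qed

text \<open>Test the supremum on \<open>[0,x[\<close> and use \<open>E n 0 = 0\<close>.\<close>

lemma discrepancy_lower:
  assumes "0 < x" "x \<le> 1"
  shows "\<bar>E n x\<bar> \<le> discrepancy (Q n) * T n"
proof -
  have "(case (0, x) of (a, b) \<Rightarrow> \<bar>E n b - E n a\<bar> / T n) \<le> discrepancy (Q n)"
    unfolding discrepancy_Q
  proof (rule cSUP_upper)
    show "bdd_above ((\<lambda>(a, b). \<bar>E n b - E n a\<bar> / T n) ` {(a, b). 0 \<le> a \<and> a < b \<and> b \<le> 1})"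
      using abs_E_diff_le[of _ _ n] 
      by (intro bdd_aboveI2[where M = "2 * (1 + (real L + 2 * real S) * (\<Sum>k<n. (real S * \<beta>)^k)) / T n"])
        auto
  qed (use assms in auto)
  then show ?thesis by (simp add: pos_divide_le_eq[OF T_pos])
qed

section \<open>The three regimes\<close>

text \<open>The equation for \<open>\<beta>\<close> gives
  \<open>(1 + \<beta>) * (1 - S * \<beta>) = (L + 1 - S) * \<beta>\<close>, so both differences have
  the same sign.\<close>

lemma S_less_iff: "S < L + 1 \<longleftrightarrow> real S * \<beta> < 1"
  and S_eq_iff: "S = L + 1 \<longleftrightarrow> real S * \<beta> = 1"
proof -
  have "(1 + \<beta>) * (1 - real S * \<beta>) = (real L + 1 - real S) * \<beta> + (1 - (real L * \<beta> + real S * \<beta>^2))"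
    by (simp add: algebra_simps power2_eq_square)
  then have *: "(1 + \<beta>) * (1 - real S * \<beta>) = (real L + 1 - real S) * \<beta>" using LS by simp
  have "real S * \<beta> < 1 \<longleftrightarrow> 0 < (1 + \<beta>) * (1 - real S * \<beta>)" using \<beta> by (simp add: zero_less_mult_iff)
  also have "\<dots> \<longleftrightarrow> real S < real L + 1" unfolding * using \<beta> by (simp add: zero_less_mult_iff)
  also have "\<dots> \<longleftrightarrow> S < L + 1" by linarith
  finally show "S < L + 1 \<longleftrightarrow> real S * \<beta> < 1" ..
  have "real S * \<beta> = 1 \<longleftrightarrow> (1 + \<beta>) * (1 - real S * \<beta>) = 0" using \<beta> by auto
  also have "\<dots> \<longleftrightarrow> real S = real L + 1" unfolding * using \<beta> by auto
  also have "\<dots> \<longleftrightarrow> S = L + 1" by linarith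
  finally show "S = L + 1 \<longleftrightarrow> real S * \<beta> = 1" ..
qed

lemma same_order_discrepancy:
  assumes "0 < c" "\<And>n. 0 \<le> g n"
    and "\<forall>\<^sub>F n in sequentially. c * g n \<le> discrepancy (Q (Suc n)) * T (Suc n)"
    and "\<forall>\<^sub>F n in sequentially. discrepancy (Q (Suc n)) * T (Suc n) \<le> C * g n"
  shows "same_order (\<lambda>n. discrepancy (Q (Suc n))) (\<lambda>n. g n / T (Suc n))"
  unfolding same_order_def
\<comment> \<open>The maximum secures \<open>c \<le> C\<close>, which \<open>same_order\<close>
  demands.\<close>
proof (rule exI[of _ c], rule exI[of _ "max c C"], intro conjI)
  show "\<forall>\<^sub>F n in sequentially. c * (g n / T (Suc n)) \<le> discrepancy (Q (Suc n)) \<and>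
      discrepancy (Q (Suc n)) \<le> max c C * (g n / T (Suc n))"
    using assms(3,4)
  proof eventually_elim
    case (elim n)
    have "discrepancy (Q (Suc n)) * T (Suc n) \<le> max c C * g n"
      using elim(2) mult_right_mono[of C "max c C" "g n"] assms(2)[of n] by linarith
    then show ?case using elim(1) T_pos[of "Suc n"] by (simp add: field_simps)
  qed
qed (use assms in auto)

text \<open>Logarithms of \<open>T_bounds\<close>: \<open>T (Suc n)\<close> lies between the powers
  \<open>n\<close> and \<open>Suc n\<close> of \<open>1 / \<beta>\<close>.\<close>

lemma T_ln: "real n * ln (1 / \<beta>) \<le> ln (T (Suc n))" "ln (T (Suc n)) \<le> real (Suc n) * ln (1 / \<beta>)"
proof -
  have b: "0 < \<beta>^k" for k using \<beta> by simp
  have 1: "(1 / \<beta>)^n \<le> T (Suc n)" "T (Suc n) \<le> (1 / \<beta>)^Suc n"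
    using T_bounds[of "Suc n"] \<beta> b[of n] by (auto simp: field_simps power_divide)
  have "ln ((1 / \<beta>)^n) \<le> ln (T (Suc n))" "ln (T (Suc n)) \<le> ln ((1 / \<beta>)^Suc n)"
    using 1 \<beta> T_pos[of "Suc n"] by (auto intro!: ln_mono simp del: power_Suc)
  then show "real n * ln (1 / \<beta>) \<le> ln (T (Suc n))" "ln (T (Suc n)) \<le> real (Suc n) * ln (1 / \<beta>)"
    using \<beta> by (simp_all only: ln_realpow divide_pos_pos zero_less_one)
qed

lemma discrepancy_order_less:
  assumes "S < L + 1"
  shows "same_order (\<lambda>n. discrepancy (Q (Suc n))) (\<lambda>n. 1 / T (Suc n))"
proof -
  define q where "q = real S * \<beta>"
  have q: "0 \<le> q" "q < 1" using assms S_less_iff \<beta> by (auto simp: q_def)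
  show ?thesis
  proof (rule same_order_discrepancy)
    show "\<forall>\<^sub>F n in sequentially. 1 * 1 \<le> discrepancy (Q (Suc n)) * T (Suc n)"
      using discrepancy_lower[of 1] by (simp add: E_1 del: Q.simps)
    have gp: "(\<Sum>k<n. q^k) \<le> 1 / (1 - q)" for n
      using sum_gp_strict[of q n] q by (simp add: divide_right_mono)
    have "2 * (1 + (real L + 2 * real S) * (\<Sum>k<n. q^k)) \<le>
        2 * (1 + (real L + 2 * real S) * (1 / (1 - q)))" for n
      by (intro mult_left_mono add_left_mono gp) simp_all
    then have "discrepancy (Q n) * T n \<le> 2 * (1 + (real L + 2 * real S) * (1 / (1 - q)))" for n
      by (rule order_trans[OF discrepancy_upper[of n, folded q_def]])
    then show "\<forall>\<^sub>F n in sequentially. discrepancy (Q (Suc n)) * T (Suc n) \<le>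
        2 * (1 + (real L + 2 * real S) * (1 / (1 - q))) * 1"
      by (intro always_eventually allI) (simp only: mult_1_right)
  qed auto
qed

lemma discrepancy_order_equal:
  assumes "S = L + 1"
  shows "same_order (\<lambda>n. discrepancy (Q (Suc n))) (\<lambda>n. ln (T (Suc n)) / T (Suc n))"
proof -
  have q: "real S * \<beta> = 1" using assms S_eq_iff by simp
  define \<mu> where "\<mu> = ln (1 / \<beta>)"
  have \<mu>: "0 < \<mu>" using \<beta> by (simp add: \<mu>_def)
  \<comment> \<open>\<open>8 * c\<close> is the gain of \<open>E_large\<close> per two levels. The
    factor 8 pays for \<open>n \<le> 2 * (Suc n div 2)\<close>, for absorbing \<open>- 1\<close>,
    and for \<open>Suc n \<le> 2 * n\<close>.\<close>
  define c where "c = (1 - \<beta>) * \<beta> / 8"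
  have c: "0 < c" using \<beta> by (simp add: c_def)
  define C where "C = real L + 2 * real S"
  have C: "0 \<le> C" by (simp add: C_def)
  have lnT: "real n * \<mu> \<le> ln (T (Suc n))" "ln (T (Suc n)) \<le> real (Suc n) * \<mu>" for n
    using T_ln[of n] by (auto simp: \<mu>_def)
  show ?thesis
  proof (rule same_order_discrepancy)
    show "0 < c / \<mu>" using c \<mu> by simp
    show "0 \<le> ln (T (Suc n))" for n
      using lnT(1)[of n] \<mu> by (meson less_imp_le mult_nonneg_nonneg of_nat_0_le_iff order_trans)
    have low: "8 * c * real (Suc n div 2) - 1 \<le> discrepancy (Q (Suc n)) * T (Suc n)" for n
    proof -
      obtain x where x: "0 < x" "x \<le> 1"
        "8 * c * real (Suc n div 2) - 1 \<le> (-1)^Suc (Suc n) * E (Suc n) x"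
        using E_large[OF q, of "Suc n"] by (auto simp: c_def)
      have "(-1)^Suc (Suc n) * E (Suc n) x \<le> \<bar>(-1)^Suc (Suc n) * E (Suc n) x\<bar>" by (rule abs_ge_self)
      also have "\<dots> = \<bar>E (Suc n) x\<bar>" by (simp add: abs_mult)
      finally show ?thesis using x discrepancy_lower[OF x(1,2), of "Suc n"] by linarith
    qed
    show "\<forall>\<^sub>F n in sequentially. c / \<mu> * ln (T (Suc n)) \<le> discrepancy (Q (Suc n)) * T (Suc n)"
      using eventually_ge_at_top[of "nat \<lceil>1 / c\<rceil>"] eventually_ge_at_top[of 1]
    proof eventually_elim
      case (elim n)
      then have "1 / c \<le> real n" by linarith
      then have n: "1 \<le> c * real n" using c by (simp add: field_simps)
      have "c / \<mu> * ln (T (Suc n)) \<le> c / \<mu> * (real (Suc n) * \<mu>)"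
        using c \<mu> lnT(2)[of n] by (intro mult_left_mono) auto
      also have "\<dots> = c * real (Suc n)" using \<mu> by simp
      also have "\<dots> \<le> c * (2 * real n)" using c elim by (intro mult_left_mono) auto
      also have "\<dots> \<le> c * (4 * real n) - 1"
        using n by simp
      also have "c * (4 * real n) \<le> c * (8 * real (Suc n div 2))"
      proof (intro mult_left_mono)
        have "n \<le> 2 * (Suc n div 2)" by linarith
        then show "4 * real n \<le> 8 * real (Suc n div 2)" by linarith
      qed (use c in simp)
      finally show ?case using low[of n] by simp
    qed
    show "\<forall>\<^sub>F n in sequentially.
        discrepancy (Q (Suc n)) * T (Suc n) \<le> 2 * (1 + 2 * C) / \<mu> * ln (T (Suc n))"
      using eventually_ge_at_top[of 1]
    proof eventually_elim
      case (elim n)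
      have "discrepancy (Q (Suc n)) * T (Suc n) \<le> 2 * (1 + C * real (Suc n))"
        using discrepancy_upper[of "Suc n"] unfolding q C_def by simp
      also have "1 + C * real (Suc n) \<le> real n + C * (2 * real n)"
        using elim C by (intro add_mono mult_left_mono) auto
      also have "2 * (real n + C * (2 * real n)) = 2 * (1 + 2 * C) / \<mu> * (real n * \<mu>)"
        using \<mu> by (simp add: field_simps)
      also have "\<dots> \<le> 2 * (1 + 2 * C) / \<mu> * ln (T (Suc n))"
        using lnT(1)[of n] \<mu> C by (intro mult_left_mono) auto
      finally show ?case by simp
    qed
  qed
qed

lemma discrepancy_order_greater:
  assumes "S > L + 1"
  shows "same_order (\<lambda>n. discrepancy (Q (Suc n)))
    (\<lambda>n. 1 / T (Suc n) powr (1 + ln (real S * \<beta>) / ln \<beta>))"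
proof -
  define q where "q = real S * \<beta>"
  have "\<not> q < 1" "q \<noteq> 1"
    using assms unfolding q_def S_less_iff[symmetric] S_eq_iff[symmetric] by linarith+
  then have q: "1 < q" by linarith
  define C where "C = real L + 2 * real S"
  have C: "0 \<le> C" by (simp add: C_def)
  \<comment> \<open>This is the exponent with \<open>(1 / \<beta>) powr \<gamma> = q\<close>; the
    exponent in the claim is \<open>1 - \<gamma>\<close>. Thus
    \<open>T (Suc n) powr \<gamma>\<close> is comparable to \<open>q^n\<close>.\<close>
  define \<gamma> where "\<gamma> = ln q / ln (1 / \<beta>)"
  have ln\<beta>: "0 < ln (1 / \<beta>)" using \<beta> by simp
  have \<gamma>: "0 < \<gamma>" "\<gamma> * ln (1 / \<beta>) = ln q" using q ln\<beta> by (auto simp: \<gamma>_def)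
  have g: "T (Suc n) powr \<gamma> / T (Suc n) = 1 / T (Suc n) powr (1 + ln (real S * \<beta>) / ln \<beta>)" for n
  proof -
    have "1 + ln (real S * \<beta>) / ln \<beta> = 1 - \<gamma>"
      using \<beta> by (simp add: \<gamma>_def q_def ln_div)
    then show ?thesis using T_pos[of "Suc n"] by (simp add: powr_diff)
  qed
  have T: "q^n \<le> T (Suc n) powr \<gamma>" "T (Suc n) powr \<gamma> \<le> q^Suc n" for n
  proof -
    have e: "q^k = exp (\<gamma> * (real k * ln (1 / \<beta>)))" for k
    proof -
      have "\<gamma> * (real k * ln (1 / \<beta>)) = real k * ln q" by (simp add: \<gamma>(2)[symmetric])
      then show ?thesis using q by (simp only:) (simp add: exp_of_nat_mult)
    qed
    have "T (Suc n) powr \<gamma> = exp (\<gamma> * ln (T (Suc n)))"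
      using T_pos[of "Suc n"] by (simp add: powr_def)
    then show "q^n \<le> T (Suc n) powr \<gamma>" "T (Suc n) powr \<gamma> \<le> q^Suc n"
      unfolding e using T_ln[of n] \<gamma>(1) by (auto intro: mult_left_mono)
  qed
  have "same_order (\<lambda>n. discrepancy (Q (Suc n))) (\<lambda>n. T (Suc n) powr \<gamma> / T (Suc n))"
  proof (rule same_order_discrepancy)
    \<comment> \<open>The 2 absorbs the \<open>- 1\<close> of \<open>E_at_\<beta>\<close> once
      \<open>q^n\<close> is large; the \<open>q\<close> comes from comparing
      \<open>T (Suc n) powr \<gamma>\<close> with \<open>q^Suc n\<close>.\<close>
    show "0 < (1 - \<beta>) / (2 * q)" using \<beta> q by simp
    show "0 \<le> T (Suc n) powr \<gamma>" for n by simp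
    obtain N where "2 / (1 - \<beta>) < q^N" using real_arch_pow[OF q] by blast
    then have "2 / (1 - \<beta>) \<le> q^n" if "N \<le> n" for n
      using power_increasing[OF that, of q] q by linarith
    then have "\<forall>\<^sub>F n in sequentially. 2 / (1 - \<beta>) \<le> q^n"
      unfolding eventually_sequentially by blast
    then show "\<forall>\<^sub>F n in sequentially.
        (1 - \<beta>) / (2 * q) * T (Suc n) powr \<gamma> \<le> discrepancy (Q (Suc n)) * T (Suc n)"
      using eventually_ge_at_top[of 1]
    proof eventually_elim
      case (elim n)
      then obtain k where k: "n = Suc k" by (cases n) auto
      have "1 \<le> (1 - \<beta>) * q^n / 2" using elim(1) \<beta> by (simp add: field_simps)
      moreover have "(1 - \<beta>) / (2 * q) * T (Suc n) powr \<gamma> \<le> (1 - \<beta>) / (2 * q) * q^Suc n"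
        using T(2)[of n] \<beta> q by (intro mult_left_mono) auto
      moreover have "(1 - \<beta>) / (2 * q) * q^Suc n = (1 - \<beta>) * q^n / 2" using q by simp
      moreover have "(1 - \<beta>) * q^n - 1 \<le> \<bar>E (Suc n) \<beta>\<bar>"
        using E_at_\<beta>[of k] abs_\<delta>[of n] unfolding k q_def by linarith
      ultimately show ?case using discrepancy_lower[of \<beta> "Suc n"] \<beta> by linarith
    qed
    have "discrepancy (Q (Suc n)) * T (Suc n) \<le> 2 * (1 + C * (q / (q - 1))) * T (Suc n) powr \<gamma>" for n
    proof -
      have gp: "(\<Sum>k<Suc n. q^k) \<le> q / (q - 1) * q^n"
        using geometric_sum[of q "Suc n"] q by (simp add: divide_right_mono)
      have "discrepancy (Q (Suc n)) * T (Suc n) \<le> 2 * (1 + C * (\<Sum>k<Suc n. q^k))"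
        using discrepancy_upper[of "Suc n"] unfolding C_def q_def .
      \<comment> \<open>Since \<open>q > 1\<close>, the constant 1 is at most \<open>q^n\<close>,
        and the geometric sum is dominated by its last term up to a factor.\<close>
      also have "\<dots> \<le> 2 * (q^n + C * (q / (q - 1) * q^n))"
        using gp C q by (intro mult_left_mono add_mono) auto
      also have "\<dots> = 2 * (1 + C * (q / (q - 1))) * q^n" by (simp add: algebra_simps)
      also have "\<dots> \<le> 2 * (1 + C * (q / (q - 1))) * T (Suc n) powr \<gamma>"
        using T(1)[of n] C q by (intro mult_left_mono) auto
      finally show ?thesis .
    qed
    then show "\<forall>\<^sub>F n in sequentially.
        discrepancy (Q (Suc n)) * T (Suc n) \<le> 2 * (1 + C * (q / (q - 1))) * T (Suc n) powr \<gamma>"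
      by simp
  qed
  then show ?thesis unfolding g .
qed

end

theorem theorem2p3:
  fixes L S :: nat and \<beta> :: real and t :: "nat \<Rightarrow> real" and D :: "nat \<Rightarrow> real"
  assumes "L \<ge> 1" and "S \<ge> 1"
    and "0 < \<beta>" and "\<beta> < 1" and "real L * \<beta> + real S * \<beta>^2 = 1"
  defines "t \<equiv> \<lambda>n. real (card (LS_partition L S \<beta> n))"
    and "D \<equiv> \<lambda>n. discrepancy (LS_partition L S \<beta> n)"
  shows "(S < L + 1 \<longrightarrow> same_order D (\<lambda>n. 1 / t n)) \<and>
         (S = L + 1 \<longrightarrow> same_order D (\<lambda>n. ln (t n) / t n)) \<and>
         (S > L + 1 \<longrightarrow>
            same_order D (\<lambda>n. 1 / t n powr (1 + ln (real S * \<beta>) / ln \<beta>)))"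
proof -
  interpret LS_parameters L S \<beta> by unfold_locales (fact assms)+
  have t: "t = (\<lambda>n. T (Suc n))" and D: "D = (\<lambda>n. discrepancy (Q (Suc n)))"
    by (simp_all only: t_def D_def LS_partition_eq T_def)
  show ?thesis unfolding t D using discrepancy_order_less discrepancy_order_equal discrepancy_order_greater by blast
qed

end
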